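(* Let $n\ge 1$, let $p_1,\dots,p_n\ge 2$ be pairwise coprime integers and $q_1,\dots,q_n$ integers with $p_1\cdots p_n\sum_{i=1}^n \frac{q_i}{p_i}=1$, and put $P=p_1\cdots p_n$. The family $\Phi=\{\Phi(q;N)\}_{N\ge1}$ of WRT functions of the Seifert loop $X(p_1/q_1,\dots,p_n/q_n)$, parametrized by the color $N$, satisfies the $q$-difference equation $$\left[\hat{\mathfrak l}^3-q^{-\frac P2}\frac{C(q\,\hat{\mathfrak m})}{C(q^{\frac12}\hat{\mathfrak m})}\,\hat{\mathfrak l}^2-q^{-2P}\hat{\mathfrak m}^{-2P}\,\hat{\mathfrak l}+q^{-\frac{3P}{2}}\frac{C(q\,\hat{\mathfrak m})}{C(q^{\frac12}\hat{\mathfrak m})}\,\hat{\mathfrak m}^{-2P}\right]\Phi=0,$$ that is, for every integer $N\ge1$, $$\Phi(q;N+3)-q^{-\frac P2}\frac{C(q^{\frac{N+2}{2}})}{C(q^{\frac{N+1}{2}})}\Phi(q;N+2)-q^{-2P-PN}\Phi(q;N+1)+q^{-\frac{3P}{2}-PN}\frac{C(q^{\frac{N+2}{2}})}{C(q^{\frac{N+1}{2}})}\Phi(q;N)=0.$$ Here $$C(\mathfrak m):=\sum_{(\varepsilon_1,\dots,\varepsilon_n)\in\{\pm1\}^n}\varepsilon_1\cdots\varepsilon_n\sum_{m=0}^\infty\binom{m+n-3}{n-3}\,q^{\frac{a_{m,\varepsilon}^2}{4P}}\bigl(\mathfrak m^{a_{m,\varepsilon}}+\mathfrak m^{-a_{m,\varepsilon}}\bigr),\qquad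 a_{m,\varepsilon}:=P\Bigl(2m+n-2+\sum_{j=1}^n\frac{\varepsilon_j}{p_j}\Bigr)\in\mathbb Z.$$
   Context: For a family $F=\{F(q;N)\}_N$ of $q$-series indexed by positive integers $N$, the operators are $(\hat{\mathfrak m}F)(q;N):=q^{N/2}F(q;N)$ and $(\hat{\mathfrak l}F)(q;N):=F(q;N+1)$, so that $\hat{\mathfrak l}\hat{\mathfrak m}=q^{1/2}\hat{\mathfrak m}\hat{\mathfrak l}$; a function of $\hat{\mathfrak m}$ acts by multiplication by its value at $\mathfrak m=q^{N/2}$. Notation: $s(q,p):=\frac{1}{4p}\sum_{\ell=1}^{p-1}\cot\bigl(\frac{\pi\ell}{p}\bigr)\cot\bigl(\frac{\pi\ell q}{p}\bigr)$ (Dedekind sum); $\Theta_0:=3-\frac1P+12\sum_{j=1}^n s(q_j,p_j)$. WRT function, for $|q|<1$: $$\Phi(q;N):=\frac{(-1)^n\,q^{-\frac14(\Theta_0+(N^2-1)P)}}{2(q^{1/2}-q^{-1/2})}\sum_{\ell=-\frac{N-1}{2}}^{\frac{N-1}{2}}\ \sum_{(\varepsilon_1,\dots,\varepsilon_n)\in\{\pm1\}^n}\varepsilon_1\cdots\varepsilon_n\sum_{m=0}^\infty\binom{m+n-3}{n-3}q^{\frac P4\left(2m+2\ell+n-2+\sum_{j=1}^n\frac{\varepsilon_j}{p_j}\right)^2},$$ where $\ell$ runs in steps of $1$. Throughout, for $n=1$ and $n=2$ the symbol $\binom{m+n-3}{n-3}$ is understood to be $1$ if $m=0$ and $0$ if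 $m\ge1$. Fractional powers are taken with respect to one fixed logarithm $h$ of $q$: $q=e^h$, $q^\alpha=e^{\alpha h}$. *)

theory Defs
  imports Complex_Main "HOL-Library.FuncSet"
begin

text \<open>Throughout, \<open>h\<close> is the chosen logarithm of \<open>q\<close>, so \<open>q = exp h\<close> and \<open>\<bar>q\<bar> < 1\<close> means \<open>Re h < 0\<close>;
  the fibre data are \<open>p 1, \<dots>, p n\<close> and \<open>r 1, \<dots>, r n\<close> (\<open>r j\<close> is the integer \<open>q\<^sub>j\<close>).\<close>

definition qpow :: "complex \<Rightarrow> real \<Rightarrow> complex" where
  "qpow h \<alpha> = exp (of_real \<alpha> * h)"

definition dedekind_sum :: "int \<Rightarrow> nat \<Rightarrow> real" where
  "dedekind_sum a b = 1 / (4 * real b) *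
     (\<Sum>l = 1..b - 1. cot (pi * real l / real b) * cot (pi * real l * of_int a / real b))"

definition total_prod :: "nat \<Rightarrow> (nat \<Rightarrow> nat) \<Rightarrow> nat" where
  "total_prod n p = (\<Prod>j = 1..n. p j)"

definition Theta0 :: "nat \<Rightarrow> (nat \<Rightarrow> nat) \<Rightarrow> (nat \<Rightarrow> int) \<Rightarrow> real" where
  "Theta0 n p r = 3 - 1 / real (total_prod n p) + 12 * (\<Sum>j = 1..n. dedekind_sum (r j) (p j))"

definition signs :: "nat \<Rightarrow> (nat \<Rightarrow> int) set" where
  "signs n = {1..n} \<rightarrow>\<^sub>E {-1, 1}"

definition sign_prod :: "nat \<Rightarrow> (nat \<Rightarrow> int) \<Rightarrow> int" where
  "sign_prod n \<epsilon> = (\<Prod>j = 1..n. \<epsilon> j)"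

text \<open>The symbol \<open>binom(m + n - 3, n - 3)\<close>, with its convention for \<open>n = 1, 2\<close>.\<close>

definition weight :: "nat \<Rightarrow> nat \<Rightarrow> nat" where
  "weight n m = (if n \<le> 2 then (if m = 0 then 1 else 0) else (m + n - 3) choose (n - 3))"

text \<open>The summation index \<open>l\<close> running from \<open>-(N-1)/2\<close> to \<open>(N-1)/2\<close> in steps of \<open>1\<close> is
  \<open>l = k - (N-1)/2\<close> with \<open>k < N\<close>.\<close>

definition WRT :: "nat \<Rightarrow> (nat \<Rightarrow> nat) \<Rightarrow> (nat \<Rightarrow> int) \<Rightarrow> complex \<Rightarrow> nat \<Rightarrow> complex" where
  "WRT n p r h N =
     (-1) ^ n * qpow h (- (1/4) * (Theta0 n p r + ((real N)\<^sup>2 - 1) * real (total_prod n p)))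
       / (2 * (qpow h (1/2) - qpow h (- (1/2)))) *
     (\<Sum>k<N. \<Sum>\<epsilon>\<in>signs n. of_int (sign_prod n \<epsilon>) *
        (\<Sum>m. of_nat (weight n m) *
           qpow h (real (total_prod n p) / 4 *
             (2 * real m + 2 * (real k - (real N - 1) / 2) + real n - 2
                + (\<Sum>j = 1..n. of_int (\<epsilon> j) / real (p j)))\<^sup>2)))"

text \<open>\<open>a\<^bsub>m,\<epsilon>\<^esub>\<close> as an integer; the divisions by \<open>p j\<close> are exact, see the lemma below.\<close>

definition a_exp :: "nat \<Rightarrow> (nat \<Rightarrow> nat) \<Rightarrow> nat \<Rightarrow> (nat \<Rightarrow> int) \<Rightarrow> int" where
  "a_exp n p m \<epsilon> = int (total_prod n p) * (2 * int m + int n - 2)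
     + (\<Sum>j = 1..n. \<epsilon> j * int (total_prod n p div p j))"

lemma of_int_a_exp:
  assumes "\<And>j. j \<in> {1..n} \<Longrightarrow> p j \<noteq> 0"
  shows "real_of_int (a_exp n p m \<epsilon>) =
    real (total_prod n p) * (2 * real m + real n - 2 + (\<Sum>j = 1..n. of_int (\<epsilon> j) / real (p j)))"
proof -
  have "real (total_prod n p div p j) = real (total_prod n p) / real (p j)" if "j \<in> {1..n}" for j
  proof -
    have "p j dvd total_prod n p"
      unfolding total_prod_def using that by (intro dvd_prodI) auto
    then show ?thesis by (rule real_of_nat_div)
  qed
  then have "(\<Sum>j = 1..n. real_of_int (\<epsilon> j) * real (total_prod n p div p j))
      = (\<Sum>j = 1..n. real (total_prod n p) * (of_int (\<epsilon> j) / real (p j)))"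
    by (intro sum.cong) auto
  then show ?thesis
    by (simp add: a_exp_def sum_distrib_left distrib_left)
qed

definition Cfun :: "nat \<Rightarrow> (nat \<Rightarrow> nat) \<Rightarrow> complex \<Rightarrow> complex \<Rightarrow> complex" where
  "Cfun n p h \<mu> = (\<Sum>\<epsilon>\<in>signs n. of_int (sign_prod n \<epsilon>) *
     (\<Sum>m. of_nat (weight n m) *
        qpow h ((of_int (a_exp n p m \<epsilon>))\<^sup>2 / (4 * real (total_prod n p))) *
        (\<mu> powi a_exp n p m \<epsilon> + \<mu> powi (- a_exp n p m \<epsilon>))))"

text \<open>The operators, acting at a fixed \<open>h\<close> on families indexed by the colour: \<open>lhat\<close> is the shift
  and \<open>mhat_fun h f\<close> is \<open>f\<close> applied to the operator of multiplication by \<open>q\<^bsup>N/2\<^esup>\<close>.\<close>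

definition lhat :: "(nat \<Rightarrow> complex) \<Rightarrow> nat \<Rightarrow> complex" where
  "lhat F N = F (N + 1)"

definition mhat_fun :: "complex \<Rightarrow> (complex \<Rightarrow> complex) \<Rightarrow> (nat \<Rightarrow> complex) \<Rightarrow> nat \<Rightarrow> complex" where
  "mhat_fun h f F N = f (qpow h (real N / 2)) * F N"

text \<open>The quotient \<open>C(q \<mu>) / C(q\<^bsup>1/2\<^esup> \<mu>)\<close>, meaningful where the denominator does not vanish.\<close>

definition Cratio :: "nat \<Rightarrow> (nat \<Rightarrow> nat) \<Rightarrow> complex \<Rightarrow> complex \<Rightarrow> complex" where
  "Cratio n p h \<mu> = Cfun n p h (qpow h 1 * \<mu>) / Cfun n p h (qpow h (1/2) * \<mu>)"

definition annihilator ::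
  "nat \<Rightarrow> (nat \<Rightarrow> nat) \<Rightarrow> complex \<Rightarrow> (nat \<Rightarrow> complex) \<Rightarrow> nat \<Rightarrow> complex" where
  "annihilator n p h F N =
     (let P = total_prod n p in
        (lhat ^^ 3) F N
        - qpow h (- (real P / 2)) * mhat_fun h (Cratio n p h) ((lhat ^^ 2) F) N
        - qpow h (- (2 * real P)) * mhat_fun h (\<lambda>\<mu>. \<mu> powi (- (2 * int P))) (lhat F) N
        + qpow h (- (3 * real P / 2)) *
            mhat_fun h (\<lambda>\<mu>. Cratio n p h \<mu> * \<mu> powi (- (2 * int P))) F N)"

end

theory Submission
  imports Defs "HOL-Real_Asymp.Real_Asymp"
begin

text \<open>Up to a factor independent of \<open>N\<close>, \<open>\<Phi>(q;N)\<close> is \<open>q\<^bsup>-PN\<^sup>2/4\<^esup> S(N)\<close>, where \<open>S(N)\<close> sums a function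
  \<open>T(j)\<close> over \<open>j = 2l = -(N-1), -(N-3), \<dots>, N-1\<close>. Hence \<open>S(N+2) - S(N) = T(N+1) + T(-(N+1))\<close>, and
  expanding \<open>(a + Pj)\<^sup>2/(4P)\<close> gives \<open>T(j) + T(-j) = q\<^bsup>Pj\<^sup>2/4\<^esup> C(q\<^bsup>j/2\<^esup>)\<close>. Eliminating the inhomogeneous
  term between this recurrence at \<open>N\<close> and at \<open>N+1\<close> produces the third-order equation.\<close>

lemma qpow_add: "qpow h (x + y) = qpow h x * qpow h y"
  by (simp add: qpow_def exp_add distrib_right)

lemma qpow_powi: "qpow h x powi k = qpow h (of_int k * x)"
  by (simp add: qpow_def exp_power_int mult.assoc)

lemma norm_qpow: "norm (qpow h x) = exp (x * Re h)"
  by (simp add: qpow_def)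

text \<open>A crude exponential bound is enough, because it is only ever weighed against Gaussian
  decay in \<open>m\<close>.\<close>

lemma weight_le: "weight n m \<le> 2 ^ n * 2 ^ m"
proof -
  have "(m + n - 3) choose (n - 3) \<le> (2::nat) ^ (m + n - 3)"
    by (rule binomial_le_pow2)
  also have "\<dots> \<le> 2 ^ (n + m)"
    by (rule power_increasing) auto
  finally show ?thesis
    by (auto simp: weight_def power_add)
qed

text \<open>Since \<open>Re h < 0\<close>, the power of q has modulus
  \<open>exp (- (B * (2 * m + c)^2))\<close> with \<open>B = - (A * Re h) > 0\<close>, which beats
  the factor \<open>2 ^ m\<close> from \<open>weight_le\<close>. This convergence justifies adding
  series termwise below.\<close>

lemma summable_weight_qpow:
  assumes "Re h < 0" and "A > 0"
  shows "summable (\<lambda>m. of_nat (weight n m) * qpow h (A * (2 * real m + c)\<^sup>2))"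
proof (rule summable_comparison_test')
  define B where "B = - (A * Re h)"
  have "B > 0"
    using assms by (simp add: B_def mult_pos_neg)
  then have "(\<lambda>m. 2 ^ m * exp (- (B * (2 * real m + c)\<^sup>2))) \<in> O(\<lambda>m. (1/2) ^ m)"
    by real_asymp
  then have "summable (\<lambda>m. 2 ^ m * exp (- (B * (2 * real m + c)\<^sup>2)))"
    by (rule summable_comparison_test_bigo [rotated]) simp
  then show "summable (\<lambda>m. 2 ^ n * (2 ^ m * exp (- (B * (2 * real m + c)\<^sup>2))))"
    by (rule summable_mult)
  show "norm (of_nat (weight n m) * qpow h (A * (2 * real m + c)\<^sup>2))
      \<le> 2 ^ n * (2 ^ m * exp (- (B * (2 * real m + c)\<^sup>2)))" for m
  proof -
    have "real (weight n m) \<le> real (2 ^ n * 2 ^ m)"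
      by (simp only: of_nat_le_iff weight_le)
    then have weight: "real (weight n m) \<le> 2 ^ n * 2 ^ m"
      by simp
    have exponent: "A * (2 * real m + c)\<^sup>2 * Re h = - (B * (2 * real m + c)\<^sup>2)"
      by (simp add: B_def)
    show ?thesis
      unfolding norm_mult norm_qpow norm_of_nat exponent mult.assoc [symmetric]
      by (rule mult_right_mono [OF weight]) simp
  qed
qed

text \<open>This is T(x) with \<open>x\<close> in the role of 2l. The bracket is grouped as
  \<open>2 * m + c\<close> to match \<open>summable_weight_qpow\<close>.\<close>

definition theta :: "nat \<Rightarrow> (nat \<Rightarrow> nat) \<Rightarrow> complex \<Rightarrow> real \<Rightarrow> complex" where
  "theta n p h x = (\<Sum>\<epsilon>\<in>signs n. of_int (sign_prod n \<epsilon>) *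
     (\<Sum>m. of_nat (weight n m) *
        qpow h (real (total_prod n p) / 4 *
          (2 * real m + (x + real n - 2 + (\<Sum>j = 1..n. of_int (\<epsilon> j) / real (p j))))\<^sup>2)))"

text \<open>In each summand, the exponents for \<open>x\<close> and \<open>- x\<close> differ only
  in the sign of the cross term a x / 2. The two cross terms give the powers a and -a of
  \<open>qpow h (x / 2)\<close> that appear together in \<open>Cfun\<close>.\<close>

lemma theta_add_theta_minus:
  assumes p: "\<And>j. j \<in> {1..n} \<Longrightarrow> p j > 0" and h: "Re h < 0"
  shows "theta n p h x + theta n p h (- x) =
    qpow h (real (total_prod n p) * x\<^sup>2 / 4) * Cfun n p h (qpow h (x / 2))"
proof -
  define P where "P = real (total_prod n p)"
  have P: "P > 0"
    using p by (auto simp: P_def total_prod_def intro!: prod_pos)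
  define f where "f x \<epsilon> m = of_nat (weight n m) * qpow h (P / 4 *
      (2 * real m + (x + real n - 2 + (\<Sum>j = 1..n. of_int (\<epsilon> j) / real (p j))))\<^sup>2)" for x \<epsilon> m
  define g where "g \<epsilon> m = of_nat (weight n m) * qpow h ((of_int (a_exp n p m \<epsilon>))\<^sup>2 / (4 * P)) *
      (qpow h (x / 2) powi a_exp n p m \<epsilon> + qpow h (x / 2) powi (- a_exp n p m \<epsilon>))" for \<epsilon> m
  have summable_f: "summable (f x \<epsilon>)" for x \<epsilon>
    unfolding f_def using h P by (intro summable_weight_qpow) auto
  have f_eq: "f y \<epsilon> m = qpow h (P * y\<^sup>2 / 4) * (of_nat (weight n m) *
      qpow h ((of_int (a_exp n p m \<epsilon>))\<^sup>2 / (4 * P)) * qpow h (of_int (a_exp n p m \<epsilon>) * (y / 2)))"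
    for y \<epsilon> m
  proof -
    define a where "a = real_of_int (a_exp n p m \<epsilon>)"
    have "a = P * (2 * real m + real n - 2 + (\<Sum>j = 1..n. of_int (\<epsilon> j) / real (p j)))"
      unfolding a_def P_def using p by (intro of_int_a_exp) auto
    then have sq: "2 * real m + (y + real n - 2 + (\<Sum>j = 1..n. of_int (\<epsilon> j) / real (p j))) = a / P + y"
      using P by simp
    have ex: "P / 4 * (a / P + y)\<^sup>2 = P * y\<^sup>2 / 4 + a\<^sup>2 / (4 * P) + a * (y / 2)"
      using P by (simp add: field_simps power2_eq_square)
    show ?thesis
      unfolding f_def a_def [symmetric] sq ex qpow_add by (simp only: mult_ac)
  qed
  have sum_f: "f x \<epsilon> m + f (- x) \<epsilon> m = qpow h (P * x\<^sup>2 / 4) * g \<epsilon> m" for \<epsilon> m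
    unfolding f_eq g_def qpow_powi by (simp add: algebra_simps)
  have "suminf (f x \<epsilon>) + suminf (f (- x) \<epsilon>) = qpow h (P * x\<^sup>2 / 4) * suminf (g \<epsilon>)" for \<epsilon>
  proof -
    \<comment> \<open>Convergence of the series in \<open>Cfun\<close> needs no new estimate: up to
      a nonzero factor, its terms are sums of two convergent theta series.\<close>
    have "summable (\<lambda>m. qpow h (P * x\<^sup>2 / 4) * g \<epsilon> m)"
      unfolding sum_f [symmetric] by (intro summable_add summable_f)
    then have "summable (g \<epsilon>)"
      by (subst (asm) summable_cmult_iff) (simp add: qpow_def)
    then show ?thesis
      by (simp add: suminf_add summable_f sum_f suminf_mult)
  qed
  then have "(\<Sum>\<epsilon>\<in>signs n. of_int (sign_prod n \<epsilon>) * suminf (f x \<epsilon>))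
      + (\<Sum>\<epsilon>\<in>signs n. of_int (sign_prod n \<epsilon>) * suminf (f (- x) \<epsilon>))
      = qpow h (P * x\<^sup>2 / 4) * (\<Sum>\<epsilon>\<in>signs n. of_int (sign_prod n \<epsilon>) * suminf (g \<epsilon>))"
    by (simp add: sum.distrib [symmetric] distrib_left [symmetric] sum_distrib_left mult.left_commute)
  then show ?thesis
    unfolding theta_def Cfun_def f_def g_def P_def .
qed

definition theta_sum :: "nat \<Rightarrow> (nat \<Rightarrow> nat) \<Rightarrow> complex \<Rightarrow> nat \<Rightarrow> complex" where
  "theta_sum n p h N = (\<Sum>k<N. theta n p h (2 * real k - (real N - 1)))"

text \<open>Raising N by 2 keeps the parity of the arguments, so the symmetric range only gains its
  two new endpoints.\<close>

lemma theta_sum_add_2: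
  "theta_sum n p h (N + 2) =
    theta_sum n p h N + (theta n p h (real (N + 1)) + theta n p h (- real (N + 1)))"
proof -
  \<comment> \<open>\<open>t\<close> follows the longer range from -(N+1) to N+1; shifting its index
    by one gives exactly the arguments of the sum for N.\<close>
  define t where "t k = theta n p h (2 * real k - (real N + 1))" for k
  have "theta_sum n p h (N + 2) = (\<Sum>k<Suc (Suc N). t k)"
    by (simp add: theta_sum_def t_def algebra_simps)
  also have "\<dots> = t 0 + (\<Sum>k<N. t (Suc k)) + t (Suc N)"
    by (subst sum.lessThan_Suc_shift) (simp add: add.assoc)
  also have "(\<Sum>k<N. t (Suc k)) = theta_sum n p h N"
    by (simp add: theta_sum_def t_def algebra_simps)
  finally show ?thesis
    by (simp add: t_def algebra_simps)
qed

lemma theta_sum_recurrence: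
  assumes "\<And>j. j \<in> {1..n} \<Longrightarrow> p j > 0" and "Re h < 0"
  shows "theta_sum n p h (N + 2) = theta_sum n p h N +
    qpow h (real (total_prod n p) * (real N + 1)\<^sup>2 / 4) * Cfun n p h (qpow h ((real N + 1) / 2))"
  using theta_add_theta_minus [of n p h "real (N + 1)", OF assms] theta_sum_add_2 [of n p h N]
  by (simp add: add.commute)

text \<open>The part -P of (N^2 - 1) P does not depend on N and is absorbed here, leaving the pure
  Gaussian q^(-P N^2 / 4).\<close>

definition WRT_const :: "nat \<Rightarrow> (nat \<Rightarrow> nat) \<Rightarrow> (nat \<Rightarrow> int) \<Rightarrow> complex \<Rightarrow> complex" where
  "WRT_const n p r h = (-1) ^ n * qpow h (- (1/4) * (Theta0 n p r - real (total_prod n p)))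
     / (2 * (qpow h (1/2) - qpow h (- (1/2))))"

lemma WRT_eq_theta_sum:
  "WRT n p r h N = WRT_const n p r h *
    (qpow h (- (real (total_prod n p) * (real N)\<^sup>2 / 4)) * theta_sum n p h N)"
proof -
  have *: "- (1/4) * (Theta0 n p r + ((real N)\<^sup>2 - 1) * real (total_prod n p))
      = - (1/4) * (Theta0 n p r - real (total_prod n p)) + - (real (total_prod n p) * (real N)\<^sup>2 / 4)"
    by (simp add: algebra_simps)
  have **: "2 * real m + 2 * (real k - (real N - 1) / 2) + real n - 2 + s
      = 2 * real m + (2 * real k - (real N - 1) + real n - 2 + s)" for m k s
    by (simp add: field_simps)
  show ?thesis
    unfolding WRT_def WRT_const_def theta_sum_def theta_def * ** qpow_add
    by (simp only: times_divide_eq_left mult.assoc)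
qed

lemma qpow_mult_WRT:
  "qpow h x * WRT n p r h N = WRT_const n p r h *
    (qpow h (x - real (total_prod n p) * (real N)\<^sup>2 / 4) * theta_sum n p h N)"
proof -
  have "qpow h (x - y) = qpow h x * qpow h (- y)" for y
    by (simp add: qpow_add [symmetric])
  then show ?thesis
    unfolding WRT_eq_theta_sum by (simp only: mult_ac)
qed

text \<open>The coefficients make the terms at N+3 and N+1 share the power q^u, and those at N+2 and
  N share q^v. Only the differences S(N+3) - S(N+1) and S(N+2) - S(N) remain, and \<open>R\<close>
  converts the C-value of the second into that of the first.\<close>

lemma WRT_recurrence:
  assumes p: "\<And>j. j \<in> {1..n} \<Longrightarrow> p j > 0" and h: "Re h < 0"
    and nz: "Cfun n p h (qpow h ((real N + 1) / 2)) \<noteq> 0"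
  defines "P \<equiv> total_prod n p"
  defines "R \<equiv> Cfun n p h (qpow h ((real N + 2) / 2)) / Cfun n p h (qpow h ((real N + 1) / 2))"
  shows "WRT n p r h (N + 3)
      - qpow h (- (real P / 2)) * R * WRT n p r h (N + 2)
      - qpow h (- (2 * real P) - real P * real N) * WRT n p r h (N + 1)
      + qpow h (- (3 * real P / 2) - real P * real N) * R * WRT n p r h N = 0"
proof -
  define K where "K = WRT_const n p r h"
  define S where "S = theta_sum n p h"
  define C where "C j = Cfun n p h (qpow h (j / 2))" for j
  define u where "u = - (real P * (real N + 3)\<^sup>2 / 4)"
  define v where "v = - (real P / 2) - real P * (real N + 2)\<^sup>2 / 4"
  \<comment> \<open>The common exponent left after the inhomogeneous terms are multiplied by q^u and
    q^v: both u + P (N+2)^2 / 4 and v + P (N+1)^2 / 4 equal \<open>d\<close>.\<close>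
  define d where "d = - (real P * (2 * real N + 5) / 4)"
  have W3: "WRT n p r h (N + 3) = K * (qpow h u * S (N + 3))"
    by (simp add: WRT_eq_theta_sum u_def K_def S_def P_def)
  have W2: "qpow h (- (real P / 2)) * WRT n p r h (N + 2) = K * (qpow h v * S (N + 2))"
    by (simp add: qpow_mult_WRT v_def K_def S_def P_def add.commute)
  have "- (2 * real P) - real P * real N - real P * (real (N + 1))\<^sup>2 / 4 = u"
    by (simp add: u_def power2_eq_square field_simps)
  then have W1: "qpow h (- (2 * real P) - real P * real N) * WRT n p r h (N + 1) =
      K * (qpow h u * S (N + 1))"
    by (simp only: qpow_mult_WRT K_def S_def P_def)
  have "- (3 * real P / 2) - real P * real N - real P * (real N)\<^sup>2 / 4 = v"
    by (simp add: v_def power2_eq_square field_simps)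
  then have W0: "qpow h (- (3 * real P / 2) - real P * real N) * WRT n p r h N =
      K * (qpow h v * S N)"
    by (simp only: qpow_mult_WRT K_def S_def P_def)
  have S3: "S (N + 3) = S (N + 1) + qpow h (real P * (real N + 2)\<^sup>2 / 4) * C (real N + 2)"
  proof -
    have "N + 3 = (N + 1) + 2" and "real (N + 1) + 1 = real N + 2"
      by simp_all
    then show ?thesis
      using theta_sum_recurrence [of n p h "N + 1", OF p h] by (simp only: S_def C_def P_def)
  qed
  have S2: "S (N + 2) = S N + qpow h (real P * (real N + 1)\<^sup>2 / 4) * C (real N + 1)"
    using theta_sum_recurrence [of n p h N, OF p h] by (simp add: S_def C_def P_def)
  have "u + real P * (real N + 2)\<^sup>2 / 4 = d"
    by (simp add: u_def d_def power2_eq_square field_simps)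
  then have u: "qpow h u * qpow h (real P * (real N + 2)\<^sup>2 / 4) = qpow h d"
    by (simp only: qpow_add [symmetric])
  have "v + real P * (real N + 1)\<^sup>2 / 4 = d"
    by (simp add: v_def d_def power2_eq_square field_simps)
  then have v: "qpow h v * qpow h (real P * (real N + 1)\<^sup>2 / 4) = qpow h d"
    by (simp only: qpow_add [symmetric])
  \<comment> \<open>The nonvanishing of C at q^((N+1)/2) enters here.\<close>
  have RC: "R * C (real N + 1) = C (real N + 2)"
    using nz by (simp add: R_def C_def)
  \<comment> \<open>Inserting both recurrences cancels S(N+1) and S(N), so only the C-terms
    survive.\<close>
  have "qpow h u * S (N + 3) - R * (qpow h v * S (N + 2)) - qpow h u * S (N + 1) + R * (qpow h v * S N)
      = (qpow h u * qpow h (real P * (real N + 2)\<^sup>2 / 4)) * C (real N + 2)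
        - (qpow h v * qpow h (real P * (real N + 1)\<^sup>2 / 4)) * (R * C (real N + 1))"
    unfolding S2 S3 by (simp add: algebra_simps)
  also have "\<dots> = 0"
    unfolding u v RC by simp
  finally have zero: "qpow h u * S (N + 3) - R * (qpow h v * S (N + 2)) - qpow h u * S (N + 1)
      + R * (qpow h v * S N) = 0" .
  have "WRT n p r h (N + 3)
      - R * (qpow h (- (real P / 2)) * WRT n p r h (N + 2))
      - qpow h (- (2 * real P) - real P * real N) * WRT n p r h (N + 1)
      + R * (qpow h (- (3 * real P / 2) - real P * real N) * WRT n p r h N)
    = K * (qpow h u * S (N + 3) - R * (qpow h v * S (N + 2)) - qpow h u * S (N + 1)
      + R * (qpow h v * S N))"
    unfolding W3 W2 W1 W0 by (simp add: algebra_simps)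
  then show ?thesis
    unfolding zero by (simp add: mult_ac)
qed

text \<open>Multipliers act after the shifts, hence are evaluated at q^(N/2) for the unshifted N.
  There q m and q^(1/2) m become q^((N+2)/2) and q^((N+1)/2), and m^(-2P) becomes q^(-PN).\<close>

lemma annihilator_eq:
  fixes n :: nat and p :: "nat \<Rightarrow> nat" and h :: complex and F :: "nat \<Rightarrow> complex"
  defines "P \<equiv> total_prod n p"
  defines "R \<equiv> \<lambda>N. Cfun n p h (qpow h ((real N + 2) / 2)) / Cfun n p h (qpow h ((real N + 1) / 2))"
  shows "annihilator n p h F N = F (N + 3)
      - qpow h (- (real P / 2)) * R N * F (N + 2)
      - qpow h (- (2 * real P) - real P * real N) * F (N + 1)
      + qpow h (- (3 * real P / 2) - real P * real N) * R N * F N"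
proof -
  have ratio: "Cratio n p h (qpow h (real N / 2)) = R N"
    by (simp add: Cratio_def R_def qpow_add [symmetric] add_divide_distrib add.commute)
  have powi: "qpow h (real N / 2) powi (- (2 * int P)) = qpow h (- (real P * real N))"
    by (simp add: qpow_powi)
  have split: "qpow h (x - real P * real N) = qpow h x * qpow h (- (real P * real N))" for x
    by (simp add: qpow_add [symmetric])
  show ?thesis
    unfolding annihilator_def Let_def mhat_fun_def P_def [symmetric] ratio powi split
    by (simp add: lhat_def eval_nat_numeral mult_ac)
qed

theorem theorem3p1:
  fixes n :: nat and p :: "nat \<Rightarrow> nat" and r :: "nat \<Rightarrow> int" and P :: nat
    and h :: complex and N :: nat
  assumes "n \<ge> 1"
    and "\<And>j. j \<in> {1..n} \<Longrightarrow> p j \<ge> 2"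
    and "\<And>i j. i \<in> {1..n} \<Longrightarrow> j \<in> {1..n} \<Longrightarrow> i \<noteq> j \<Longrightarrow> coprime (p i) (p j)"
    and "P = total_prod n p"
    and "real P * (\<Sum>i = 1..n. real_of_int (r i) / real (p i)) = 1"
    and "Re h < 0"
    and "N \<ge> 1"
    and "Cfun n p h (qpow h ((real N + 1) / 2)) \<noteq> 0"
  shows "annihilator n p h (WRT n p r h) N = 0
    \<and> WRT n p r h (N + 3)
      - qpow h (- (real P / 2))
          * (Cfun n p h (qpow h ((real N + 2) / 2)) / Cfun n p h (qpow h ((real N + 1) / 2)))
          * WRT n p r h (N + 2)
      - qpow h (- (2 * real P) - real P * real N) * WRT n p r h (N + 1)
      + qpow h (- (3 * real P / 2) - real P * real N)
          * (Cfun n p h (qpow h ((real N + 2) / 2)) / Cfun n p h (qpow h ((real N + 1) / 2)))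
          * WRT n p r h N = 0"
proof -
  have "p j > 0" if "j \<in> {1..n}" for j
    using assms(2) [OF that] by simp
  \<comment> \<open>Once the operators are evaluated, both conjuncts are the same scalar
    identity.\<close>
  from WRT_recurrence [of n p h N r, OF this assms(6,8)] show ?thesis
    unfolding annihilator_eq assms(4) by blast
qed

end
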